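(* Consider the homogeneous MCST problem with products $\mathcal N=\{1,\dots,n\}$ sorted so that $r_1\ge r_2\ge\cdots\ge r_n$, and the following algorithm. (1) Set $RV_1:=r_1v_1$ and $V_1:=v_0+v_1$; for $i=2,\dots,n-1$ set $RV_i:=RV_{i-1}+r_iv_i$ and $V_i:=V_{i-1}+v_i$. (2) For $i=2,\dots,n$ in order: compute $r_i^{(i-1)}:=r_i-\dfrac{RV_{i-1}}{V_{i-1}}$; if $r_i^{(i-1)}<0$, stop and return $S^*=\{1,\dots,i-1\}$. (3) If the loop ends without returning, return $S^*=\{1,\dots,n\}$. Then the algorithm finishes in $O(n)$ time, and the returned $S^*$ is an optimal assortment for the homogeneous MCST problem.
   Context: Products are $\mathcal N=\{1,\dots,n\}$; $0$ denotes the no-purchase option. Product $j$ has a fixed revenue $r_j$. Arrival probabilities satisfy $\lambda_j\ge0$, $\sum_{j=1}^n\lambda_j=1$; homogeneous transition weights (the same for every starting product) satisfy $v_i\ge0$ for $i\in\mathcal N\cup\{0\}$, $\sum_{i\in\mathcal N\cup\{0\}} v_i=1$. Homogeneous MCST problem (assortment optimization under the Markov chain choice model with single transition, with transition weights independent of the starting product): choose an offered assortment $S\subseteq\mathcal N$ and, for each $j\in\mathcal N\setminus S$, a recommended set $R_j\subseteq S$, maximizing the expected revenue $$\mathbf R(S,\{R_j\}_{j\notin S})=\sum_{i\in S}\lambda_i r_i+\sum_{j\notin S}\lambda_j\frac{\sum_{i\in R_j}r_iv_i}{\sum_{i\in R_j}v_i+v_0}.$$ An assortment $S$ is optimal if it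 attains the maximum for some choice of recommended sets. The convention $0/0=0$ is used throughout.
   Formalization: The formal statement adds the assumption that the largest revenue r_1 is nonnegative; without it the claim fails, e.g. n=1, λ_1=1, r_1=-1, where the algorithm returns {1} with revenue -1 but the empty assortment earns 0. *)

theory Defs
  imports Complex_Main "HOL-Library.Landau_Symbols" "HOL-Library.Monad_Syntax"
begin

text \<open>
  Products are \<open>{1..n}\<close>; index \<open>0\<close> of the weight vector is the no-purchase option.
\<close>

definition homogeneous_mcst :: "nat \<Rightarrow> (nat \<Rightarrow> real) \<Rightarrow> (nat \<Rightarrow> real) \<Rightarrow> bool" where
  "homogeneous_mcst n lam v \<longleftrightarrow>
     (\<forall>j\<in>{1..n}. 0 \<le> lam j) \<and> (\<Sum>j=1..n. lam j) = 1 \<and>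
     (\<forall>i\<in>{0..n}. 0 \<le> v i) \<and> (\<Sum>i=0..n. v i) = 1"

definition mcst_feasible :: "nat \<Rightarrow> nat set \<Rightarrow> (nat \<Rightarrow> nat set) \<Rightarrow> bool" where
  "mcst_feasible n S R \<longleftrightarrow> S \<subseteq> {1..n} \<and> (\<forall>j\<in>{1..n} - S. R j \<subseteq> S)"

text \<open>
  HOL's \<open>x / 0 = 0\<close> agrees with the convention \<open>0 / 0 = 0\<close>: since the weights are nonnegative,
  the numerator vanishes whenever the denominator does.
\<close>

definition mcst_revenue ::
  "nat \<Rightarrow> (nat \<Rightarrow> real) \<Rightarrow> (nat \<Rightarrow> real) \<Rightarrow> (nat \<Rightarrow> real) \<Rightarrow> nat set \<Rightarrow> (nat \<Rightarrow> nat set) \<Rightarrow> real" where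
  "mcst_revenue n lam v r S R =
     (\<Sum>i\<in>S. lam i * r i) +
     (\<Sum>j\<in>{1..n} - S. lam j * ((\<Sum>i\<in>R j. r i * v i) / ((\<Sum>i\<in>R j. v i) + v 0)))"

definition mcst_optimal ::
  "nat \<Rightarrow> (nat \<Rightarrow> real) \<Rightarrow> (nat \<Rightarrow> real) \<Rightarrow> (nat \<Rightarrow> real) \<Rightarrow> nat set \<Rightarrow> bool" where
  "mcst_optimal n lam v r S \<longleftrightarrow>
     (\<exists>R. mcst_feasible n S R \<and>
        (\<forall>S' R'. mcst_feasible n S' R' \<longrightarrow>
           mcst_revenue n lam v r S' R' \<le> mcst_revenue n lam v r S R))"

text \<open>
  Running time is measured in the unit-cost real RAM model: a computation is its result together
  with the number of steps taken.  One step is charged for every arithmetic operation or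
  comparison, every array access, every loop test, and every element put into the returned set;
  allocating an array costs its length.
\<close>

datatype 'a tm = TM (result: 'a) (steps: nat)

definition return :: "'a \<Rightarrow> 'a tm" where
  "return x = TM x 0"

definition bind_tm :: "'a tm \<Rightarrow> ('a \<Rightarrow> 'b tm) \<Rightarrow> 'b tm" where
  "bind_tm c f = TM (result (f (result c))) (steps c + steps (f (result c)))"

adhoc_overloading Monad_Syntax.bind \<rightleftharpoons> bind_tm

definition tick :: "unit tm" where
  "tick = TM () 1"

definition prim :: "('a \<Rightarrow> 'b \<Rightarrow> 'c) \<Rightarrow> 'a \<Rightarrow> 'b \<Rightarrow> 'c tm" where
  "prim f x y = TM (f x y) 1"

definition new_array :: "nat \<Rightarrow> (nat \<Rightarrow> real) tm" where
  "new_array len = TM (\<lambda>_. 0) len"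

definition get :: "(nat \<Rightarrow> real) \<Rightarrow> nat \<Rightarrow> real tm" where
  "get a i = TM (a i) 1"

definition put :: "(nat \<Rightarrow> real) \<Rightarrow> nat \<Rightarrow> real \<Rightarrow> (nat \<Rightarrow> real) tm" where
  "put a i x = TM (a(i := x)) 1"

text \<open>
  The loop \<open>i, \<dots>, n - 1\<close> that fills the arrays \<open>RV\<close> and \<open>V\<close>.  In both loops, the result of
  \<open>prim (+) i 1\<close> is discarded because the recursive call has to mention \<open>i + 1\<close> itself for the
  termination proof; the command only charges for the increment.
\<close>

function fill_sums ::
  "nat \<Rightarrow> (nat \<Rightarrow> real) \<Rightarrow> (nat \<Rightarrow> real) \<Rightarrow> nat \<Rightarrow> (nat \<Rightarrow> real) \<Rightarrow> (nat \<Rightarrow> real) \<Rightarrow>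
   ((nat \<Rightarrow> real) \<times> (nat \<Rightarrow> real)) tm" where
  "fill_sums n r v i RV V =
     (if i < n then do {
        tick;
        k \<leftarrow> prim (-) i 1;
        ri \<leftarrow> get r i;
        vi \<leftarrow> get v i;
        RVk \<leftarrow> get RV k;
        Vk \<leftarrow> get V k;
        p \<leftarrow> prim (*) ri vi;
        x \<leftarrow> prim (+) RVk p;
        y \<leftarrow> prim (+) Vk vi;
        RV' \<leftarrow> put RV i x;
        V' \<leftarrow> put V i y;
        prim (+) i 1;
        fill_sums n r v (i + 1) RV' V'
      } else do { tick; return (RV, V) })"
  by pat_completeness auto
termination by (relation "measure (\<lambda>(n, r, v, i, RV, V). n - i)") auto

declare fill_sums.simps [simp del]

definition prefix_sums ::
  "nat \<Rightarrow> (nat \<Rightarrow> real) \<Rightarrow> (nat \<Rightarrow> real) \<Rightarrow> ((nat \<Rightarrow> real) \<times> (nat \<Rightarrow> real)) tm" where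
  "prefix_sums n r v = do {
     RV \<leftarrow> new_array n;
     V \<leftarrow> new_array n;
     r1 \<leftarrow> get r 1;
     v1 \<leftarrow> get v 1;
     v0 \<leftarrow> get v 0;
     x \<leftarrow> prim (*) r1 v1;
     y \<leftarrow> prim (+) v0 v1;
     RV' \<leftarrow> put RV 1 x;
     V' \<leftarrow> put V 1 y;
     fill_sums n r v 2 RV' V'
   }"

text \<open>Writes out the set \<open>{1..k}\<close> element by element.\<close>

fun output_upto :: "nat \<Rightarrow> nat set tm" where
  "output_upto 0 = do { tick; return {} }"
| "output_upto (Suc k) = do {
     tick;
     S \<leftarrow> output_upto k;
     prim insert (Suc k) S
   }"

function scan ::
  "nat \<Rightarrow> (nat \<Rightarrow> real) \<Rightarrow> (nat \<Rightarrow> real) \<Rightarrow> (nat \<Rightarrow> real) \<Rightarrow> nat \<Rightarrow> nat set tm" where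
  "scan n r RV V i =
     (if i \<le> n then do {
        tick;
        k \<leftarrow> prim (-) i 1;
        ri \<leftarrow> get r i;
        RVk \<leftarrow> get RV k;
        Vk \<leftarrow> get V k;
        q \<leftarrow> prim (/) RVk Vk;
        d \<leftarrow> prim (-) ri q;
        neg \<leftarrow> prim (<) d 0;
        if neg then output_upto k
        else do {
          prim (+) i 1;
          scan n r RV V (i + 1)
        }
      } else do { tick; output_upto n })"
  by pat_completeness auto
termination by (relation "measure (\<lambda>(n, r, RV, V, i). Suc n - i)") auto

declare scan.simps [simp del]

definition mcst_algorithm :: "nat \<Rightarrow> (nat \<Rightarrow> real) \<Rightarrow> (nat \<Rightarrow> real) \<Rightarrow> nat set tm" where
  "mcst_algorithm n v r = do {
     (RV, V) \<leftarrow> prefix_sums n r v;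
     scan n r RV V 2
   }"

text \<open>
  The algorithm never returns the empty assortment, so its correctness needs \<open>0 \<le> r 1\<close>: for
  \<open>n = 1\<close>, \<open>lam 1 = 1\<close> and \<open>r 1 = -1\<close> it returns \<open>{1}\<close> with revenue \<open>-1\<close>, while \<open>{}\<close> has
  revenue \<open>0\<close>.  The revenues of the other products need no sign condition.
\<close>

end

theory Submission
  imports Defs
begin

text \<open>
  Offering a product \<open>j\<close> earns \<open>r j\<close> from the customers who arrive for it; withholding it earns
  the revenue of the recommended set shown to them.  Since the transition weights do not depend on
  \<open>j\<close>, the best recommendation is worth the same amount \<open>g\<close> to all withheld products, and no
  solution can earn more than \<open>\<Sum>j. lam j * max (r j) g\<close>.  This bound is attained as soon as one
  set \<open>{1..k}\<close> is both the best recommendation and the set of products with \<open>r j \<ge> g\<close>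
  (up to ties): offer it, and recommend all of it.

  The algorithm finds such a \<open>k\<close>.  Let \<open>g k\<close> be the revenue of recommending \<open>{1..k}\<close>.
  Passing the test \<open>r i \<ge> g (i - 1)\<close> implies that \<open>g i\<close>, a weighted average of
  \<open>g (i - 1)\<close> and \<open>r i\<close>, does not exceed \<open>r i\<close>; at the end \<open>g k \<le> r k\<close>
  (\<open>recommendation_revenue_stopping_bounds\<close>), while failing the test at \<open>k + 1\<close> says
  \<open>r (k + 1) < g k\<close>.  As revenues are sorted, \<open>g k\<close> separates \<open>{1..k}\<close> from the rest.
  A set that is separated in this way from its complement by its own recommendation revenue is a
  best recommendation, because
  \<open>\<Sum>i\<in>A. (r i - g) * v i\<close> is largest when \<open>A\<close> collects the nonnegative terms
  (\<open>recommendation_revenue_threshold_max\<close>).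

  The sign condition on \<open>r 1\<close> enters at the start of the induction: it gives \<open>0 \<le> g 1 \<le> r 1\<close>,
  and then every \<open>g k\<close> reached by the loop is nonnegative.  That covers recommendations of
  weight \<open>0\<close>, whose revenue is \<open>0\<close> by convention and not by averaging.
\<close>

section \<open>Best recommendations\<close>

definition recommendation_revenue ::
  "(nat \<Rightarrow> real) \<Rightarrow> (nat \<Rightarrow> real) \<Rightarrow> nat set \<Rightarrow> real" where
  "recommendation_revenue v r A = (\<Sum>i\<in>A. r i * v i) / ((\<Sum>i\<in>A. v i) + v 0)"

lemma sum_weights_zero_imp_sum_revenue_zero:
  fixes v r :: "nat \<Rightarrow> real"
  assumes "finite A" "\<And>i. i \<in> A \<Longrightarrow> 0 \<le> v i" "0 \<le> v 0" "(\<Sum>i\<in>A. v i) + v 0 = 0"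
  shows "(\<Sum>i\<in>A. r i * v i) = 0"
proof -
  have "0 \<le> (\<Sum>i\<in>A. v i)"
    using assms(2) by (rule sum_nonneg)
  then have "(\<Sum>i\<in>A. v i) = 0"
    using assms(3,4) by linarith
  then have "\<forall>i\<in>A. v i = 0"
    using sum_nonneg_eq_0_iff[OF assms(1), of v] assms(2) by blast
  then show ?thesis
    by simp
qed

text \<open>
  The new quotient is an average of \<open>a / b\<close> and \<open>x\<close> with weights \<open>b\<close> and \<open>w\<close>.  If both
  weights vanish it is \<open>0 / 0 = 0\<close>, which is still at most \<open>x\<close> because \<open>0 \<le> a / b \<le> x\<close>.
\<close>

lemma weighted_average_bounds:
  fixes a b x w :: real
  assumes "0 \<le> b" "0 \<le> w" "b = 0 \<Longrightarrow> a = 0" "0 \<le> a / b" "a / b \<le> x"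
  shows "0 \<le> (a + x * w) / (b + w)" "(a + x * w) / (b + w) \<le> x"
proof -
  have x: "0 \<le> x"
    using assms(4,5) by linarith
  have a: "0 \<le> a" "a \<le> x * b"
    using assms by (cases "b = 0"; simp add: field_simps zero_le_divide_iff)+
  show "0 \<le> (a + x * w) / (b + w)"
    using a x assms(1,2) by simp
  have "a + x * w \<le> x * (b + w)"
    using a by (simp add: algebra_simps)
  then show "(a + x * w) / (b + w) \<le> x"
    using x assms(1,2) by (cases "b + w = 0") (simp_all add: pos_divide_le_eq)
qed

text \<open>
  Multiplying out, \<open>g A\<close> bounds the revenue of a \<open>B\<close> of positive weight iff
  \<open>(\<Sum>i\<in>B. (r i - g A) * v i) \<le> g A * v 0\<close>.  Equality holds for \<open>A\<close> itself, and exchanging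
  \<open>A\<close> for \<open>B\<close> drops nonnegative terms and adds nonpositive ones.
\<close>

lemma recommendation_revenue_threshold_max:
  fixes v r :: "nat \<Rightarrow> real"
  defines "g \<equiv> recommendation_revenue v r"
  assumes fin: "finite A" "finite B"
    and v: "\<And>i. i \<in> A \<union> B \<Longrightarrow> 0 \<le> v i" "0 \<le> v 0"
    and above: "\<And>i. i \<in> A \<Longrightarrow> g A \<le> r i"
    and below: "\<And>i. i \<in> B - A \<Longrightarrow> r i \<le> g A"
    and nonneg: "0 \<le> g A"
  shows "g B \<le> g A"
proof -
  define excess where "excess C = (\<Sum>i\<in>C. (r i - g A) * v i)" for C
  have excess: "excess C = (\<Sum>i\<in>C. r i * v i) - g A * (\<Sum>i\<in>C. v i)" for C
    unfolding excess_def by (simp add: left_diff_distrib sum_subtractf sum_distrib_left)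
  have "(\<Sum>i\<in>A. r i * v i) = g A * ((\<Sum>i\<in>A. v i) + v 0)"
    using sum_weights_zero_imp_sum_revenue_zero[of A v r] fin v
    by (cases "(\<Sum>i\<in>A. v i) + v 0 = 0") (auto simp: g_def recommendation_revenue_def)
  then have A: "excess A = g A * v 0"
    unfolding excess by (simp add: algebra_simps)
  have "excess B = excess (A \<inter> B) + excess (B - A)"
    unfolding excess_def using fin sum.Int_Diff[of B _ A] by (simp add: Int_commute)
  moreover have "excess A = excess (A \<inter> B) + excess (A - B)"
    unfolding excess_def using fin sum.Int_Diff[of A _ B] by simp
  moreover have "excess (B - A) \<le> 0"
    unfolding excess_def using v below by (intro sum_nonpos mult_nonpos_nonneg) auto
  moreover have "0 \<le> excess (A - B)"
    unfolding excess_def using v above by (intro sum_nonneg mult_nonneg_nonneg) auto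
  ultimately have "excess B \<le> g A * v 0"
    using A by linarith
  then have le: "(\<Sum>i\<in>B. r i * v i) \<le> g A * ((\<Sum>i\<in>B. v i) + v 0)"
    unfolding excess by (simp add: algebra_simps)
  have "0 \<le> (\<Sum>i\<in>B. v i) + v 0"
    using v by (intro add_nonneg_nonneg sum_nonneg) auto
  then show ?thesis
    using le nonneg unfolding g_def recommendation_revenue_def[of v r B]
    by (cases "(\<Sum>i\<in>B. v i) + v 0 = 0") (simp_all add: pos_divide_le_eq)
qed

section \<open>Optimality at a stopping index\<close>

definition stopping_index :: "nat \<Rightarrow> (nat \<Rightarrow> real) \<Rightarrow> (nat \<Rightarrow> real) \<Rightarrow> nat \<Rightarrow> bool" where
  "stopping_index n v r k \<longleftrightarrow>
     k \<in> {1..n} \<and>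
     (\<forall>i\<in>{2..k}. recommendation_revenue v r {1..i - 1} \<le> r i) \<and>
     (k < n \<longrightarrow> r (k + 1) < recommendation_revenue v r {1..k})"

text \<open>
  An invariant of the loop: a product that passes its test enters the average from above and
  cannot lift it beyond its own revenue.
\<close>

lemma recommendation_revenue_stopping_bounds:
  fixes v r :: "nat \<Rightarrow> real"
  defines "g k \<equiv> recommendation_revenue v r {1..k}"
  assumes "1 \<le> k" and v: "\<And>i. i \<le> k \<Longrightarrow> 0 \<le> v i" and r1: "0 \<le> r 1"
    and passed: "\<And>i. i \<in> {2..k} \<Longrightarrow> g (i - 1) \<le> r i"
  shows "0 \<le> g k \<and> g k \<le> r k"
  using assms(2) v passed
proof (induction k rule: dec_induct)
  case base
  (* Before the first product the average has weight v 0 and value 0. *)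
  show ?case
    using weighted_average_bounds[of "v 0" "v 1" 0 "r 1"] base.prems(1)[of 0]
      base.prems(1)[of 1] r1
    by (simp add: g_def recommendation_revenue_def add.commute)
next
  case (step k)
  have IH: "0 \<le> g k"
    using step.IH step.prems by simp
  have vs: "0 \<le> v i" if "i \<in> {1..k}" for i
    using step.prems(1)[of i] that by simp
  have next_le: "g k \<le> r (Suc k)"
    using step.prems(2)[of "Suc k"] step.hyps by simp
  have "0 \<le> (\<Sum>i=1..k. v i) + v 0"
    using step.prems(1)[of 0] vs by (intro add_nonneg_nonneg sum_nonneg) auto
  moreover have "(\<Sum>i=1..k. r i * v i) = 0" if "(\<Sum>i=1..k. v i) + v 0 = 0"
    using sum_weights_zero_imp_sum_revenue_zero[of "{1..k}" v r] vs step.prems(1)[of 0] that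
    by blast
  ultimately show ?case
    using weighted_average_bounds[of "(\<Sum>i=1..k. v i) + v 0" "v (Suc k)"
        "\<Sum>i=1..k. r i * v i" "r (Suc k)"] IH next_le step.prems(1)[of "Suc k"]
    by (simp add: g_def recommendation_revenue_def add_ac)
qed

text \<open>
  Charging each arrival \<open>j\<close> separately, a solution earns at most \<open>max (r j) g\<close> from it if \<open>g\<close>
  bounds the revenue of all recommendations.
\<close>

lemma mcst_revenue_le_sum_max:
  assumes feasible: "mcst_feasible n S R" and lam: "\<And>j. j \<in> {1..n} \<Longrightarrow> 0 \<le> lam j"
    and g: "\<And>A. A \<subseteq> {1..n} \<Longrightarrow> recommendation_revenue v r A \<le> g"
  shows "mcst_revenue n lam v r S R \<le> (\<Sum>j=1..n. lam j * max (r j) g)"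
proof -
  have S: "S \<subseteq> {1..n}"
    using feasible unfolding mcst_feasible_def by blast
  have R: "R j \<subseteq> {1..n}" if "j \<in> {1..n} - S" for j
    using feasible that unfolding mcst_feasible_def by blast
  have "mcst_revenue n lam v r S R =
      (\<Sum>j\<in>S. lam j * r j) + (\<Sum>j\<in>{1..n} - S. lam j * recommendation_revenue v r (R j))"
    by (simp add: mcst_revenue_def recommendation_revenue_def)
  also have "\<dots> \<le> (\<Sum>j\<in>S. lam j * max (r j) g) + (\<Sum>j\<in>{1..n} - S. lam j * max (r j) g)"
    using S lam R g
    by (intro add_mono sum_mono mult_left_mono) (auto simp: le_max_iff_disj)
  also have "\<dots> = (\<Sum>j=1..n. lam j * max (r j) g)"
    using sum.subset_diff[OF S, of "\<lambda>j. lam j * max (r j) g"] by simp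
  finally show ?thesis .
qed

lemma mcst_optimal_if_stopping_index:
  assumes mcst: "homogeneous_mcst n lam v"
    and sorted: "\<And>i j. 1 \<le> i \<Longrightarrow> i \<le> j \<Longrightarrow> j \<le> n \<Longrightarrow> r j \<le> r i"
    and r1: "0 \<le> r 1" and stop: "stopping_index n v r k"
  shows "mcst_optimal n lam v r {1..k}"
proof -
  define g where "g = recommendation_revenue v r {1..k}"
  have lam: "0 \<le> lam j" if "j \<in> {1..n}" for j
    using mcst that unfolding homogeneous_mcst_def by blast
  have v: "0 \<le> v i" if "i \<le> n" for i
    using mcst that unfolding homogeneous_mcst_def by simp
  have k: "1 \<le> k" "k \<le> n"
    using stop unfolding stopping_index_def by auto
  have g: "0 \<le> g" "g \<le> r k"
    using recommendation_revenue_stopping_bounds[of k v r] k v r1 stop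
    unfolding g_def stopping_index_def by auto
  have above: "g \<le> r j" if "j \<in> {1..k}" for j
    using sorted[of j k] that k g(2) by simp
  have below: "r j \<le> g" if "j \<in> {1..n} - {1..k}" for j
  proof -
    have "k < n" "k + 1 \<le> j" "j \<le> n"
      using that k by auto
    then show ?thesis
      using sorted[of "k + 1" j] stop unfolding stopping_index_def g_def by simp
  qed
  have best: "recommendation_revenue v r A \<le> g" if "A \<subseteq> {1..n}" for A
    unfolding g_def
  proof (rule recommendation_revenue_threshold_max)
    show "finite A"
      using that finite_subset by blast
    show "0 \<le> v i" if "i \<in> {1..k} \<union> A" for i
      using that \<open>A \<subseteq> {1..n}\<close> k v by auto
    show "recommendation_revenue v r {1..k} \<le> r i" if "i \<in> {1..k}" for i
      using above that unfolding g_def by blast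
    show "r i \<le> recommendation_revenue v r {1..k}" if "i \<in> A - {1..k}" for i
      using below that \<open>A \<subseteq> {1..n}\<close> unfolding g_def by blast
  qed (use v g(1) in \<open>auto simp: g_def\<close>)
  have sub: "{1..k} \<subseteq> {1..n}"
    using k by auto
  have "mcst_revenue n lam v r {1..k} (\<lambda>_. {1..k}) =
      (\<Sum>j\<in>{1..k}. lam j * r j) + (\<Sum>j\<in>{1..n} - {1..k}. lam j * g)"
    by (simp add: mcst_revenue_def g_def recommendation_revenue_def)
  also have "\<dots> = (\<Sum>j\<in>{1..k}. lam j * max (r j) g) + (\<Sum>j\<in>{1..n} - {1..k}. lam j * max (r j) g)"
    using above below
    by (intro arg_cong2[of _ _ _ _ "(+)"] sum.cong) (simp_all add: max_absorb1 max_absorb2)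
  also have "\<dots> = (\<Sum>j=1..n. lam j * max (r j) g)"
    using sum.subset_diff[OF sub, of "\<lambda>j. lam j * max (r j) g"] by simp
  finally have attained:
    "mcst_revenue n lam v r {1..k} (\<lambda>_. {1..k}) = (\<Sum>j=1..n. lam j * max (r j) g)" .
  show ?thesis
    unfolding mcst_optimal_def
  proof (intro exI[of _ "\<lambda>_. {1..k}"] conjI allI impI)
    show "mcst_feasible n {1..k} (\<lambda>_. {1..k})"
      using sub unfolding mcst_feasible_def by blast
    show "mcst_revenue n lam v r S R \<le> mcst_revenue n lam v r {1..k} (\<lambda>_. {1..k})"
      if "mcst_feasible n S R" for S R
      unfolding attained by (rule mcst_revenue_le_sum_max) (use that lam best in auto)
  qed
qed

section \<open>Correctness of the algorithm\<close>

lemmas tm_defs = bind_tm_def return_def tick_def prim_def new_array_def get_def put_def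

definition prefix_sums_below ::
  "nat \<Rightarrow> (nat \<Rightarrow> real) \<Rightarrow> (nat \<Rightarrow> real) \<Rightarrow> (nat \<Rightarrow> real) \<Rightarrow> (nat \<Rightarrow> real) \<Rightarrow> bool" where
  "prefix_sums_below i r v RV V \<longleftrightarrow>
     (\<forall>m\<in>{1..<i}. RV m = (\<Sum>j=1..m. r j * v j) \<and> V m = (\<Sum>j=1..m. v j) + v 0)"

lemma prefix_sums_below_step:
  assumes "prefix_sums_below i r v RV V" "2 \<le> i"
  shows "prefix_sums_below (i + 1) r v
           (RV(i := RV (i - 1) + r i * v i)) (V(i := V (i - 1) + v i))"
proof -
  obtain m where m: "i = Suc m" "1 \<le> m"
    using assms(2) by (cases i) auto
  show ?thesis
    using assms(1) m unfolding prefix_sums_below_def by (auto simp: less_Suc_eq)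
qed

lemma fill_sums_correct:
  assumes "prefix_sums_below i r v RV V" "2 \<le> i"
  shows "case result (fill_sums n r v i RV V) of (RV', V') \<Rightarrow> prefix_sums_below n r v RV' V'"
  using assms
proof (induction n r v i RV V rule: fill_sums.induct)
  case (1 n r v i RV V)
  show ?case
  proof (cases "i < n")
    case True
    have "prefix_sums_below (i + 1) r v
            (RV(i := RV (i - 1) + r i * v i)) (V(i := V (i - 1) + v i))"
      using prefix_sums_below_step "1.prems" by blast
    then show ?thesis
      using True "1.IH" "1.prems"(2)
      by (subst fill_sums.simps) (simp add: tm_defs)
  next
    case False
    then show ?thesis
      using "1.prems"
      by (subst fill_sums.simps) (simp add: tm_defs prefix_sums_below_def)
  qed
qed

lemma prefix_sums_correct:
  "case result (prefix_sums n r v) of (RV, V) \<Rightarrow> prefix_sums_below n r v RV V"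
proof -
  have "prefix_sums_below 2 r v ((\<lambda>_. 0)(1 := r 1 * v 1)) ((\<lambda>_. 0)(1 := v 0 + v 1))"
    by (auto simp: prefix_sums_below_def less_Suc_eq numeral_2_eq_2)
  from fill_sums_correct[OF this, of n] show ?thesis
    by (simp add: prefix_sums_def tm_defs)
qed

lemma result_output_upto: "result (output_upto k) = {1..k}"
  by (induction k) (auto simp: tm_defs)

lemma scan_returns_stopping_index:
  assumes "prefix_sums_below n r v RV V" "2 \<le> i" "i \<le> n + 1"
    and "\<And>m. m \<in> {2..<i} \<Longrightarrow> recommendation_revenue v r {1..m - 1} \<le> r m"
  shows "\<exists>k. result (scan n r RV V i) = {1..k} \<and> stopping_index n v r k"
  using assms
proof (induction n r RV V i rule: scan.induct)
  case (1 n r RV V i)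
  show ?case
  proof (cases "i \<le> n")
    case True
    have g: "RV (i - 1) / V (i - 1) = recommendation_revenue v r {1..i - 1}"
    proof -
      have "i - 1 \<in> {1..<n}"
        using True "1.prems"(2) by auto
      then show ?thesis
        using "1.prems"(1) unfolding prefix_sums_below_def recommendation_revenue_def by simp
    qed
    show ?thesis
    proof (cases "r i - RV (i - 1) / V (i - 1) < 0")
      case neg: True
      have "result (scan n r RV V i) = {1..i - 1}"
        using True neg by (subst scan.simps) (simp add: tm_defs result_output_upto)
      moreover have "stopping_index n v r (i - 1)"
        using True neg "1.prems"(2,4) unfolding g stopping_index_def by auto
      ultimately show ?thesis
        by blast
    next
      case pos: False
      have "result (scan n r RV V i) = result (scan n r RV V (i + 1))"
        using True pos by (subst scan.simps) (simp add: tm_defs)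
      moreover have "\<exists>k. result (scan n r RV V (i + 1)) = {1..k} \<and> stopping_index n v r k"
      proof (rule "1.IH")
        show "recommendation_revenue v r {1..m - 1} \<le> r m" if "m \<in> {2..<i + 1}" for m
          using that "1.prems"(4)[of m] pos unfolding g by (cases "m = i") auto
      qed (use True pos "1.prems" in auto)
      ultimately show ?thesis
        by simp
    qed
  next
    case False
    then have "i = n + 1"
      using "1.prems"(3) by simp
    then have "stopping_index n v r n"
      using "1.prems"(2,4) unfolding stopping_index_def by auto
    moreover have "result (scan n r RV V i) = {1..n}"
      using False by (subst scan.simps) (simp add: tm_defs result_output_upto)
    ultimately show ?thesis
      by blast
  qed
qed

lemma mcst_algorithm_returns_stopping_index:
  assumes "1 \<le> n"
  shows "\<exists>k. result (mcst_algorithm n v r) = {1..k} \<and> stopping_index n v r k"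
proof -
  obtain RV V where RV: "result (prefix_sums n r v) = (RV, V)"
    by (cases "result (prefix_sums n r v)")
  then have "prefix_sums_below n r v RV V"
    using prefix_sums_correct[of n r v] by simp
  then have "\<exists>k. result (scan n r RV V 2) = {1..k} \<and> stopping_index n v r k"
    using assms by (intro scan_returns_stopping_index) auto
  then show ?thesis
    by (simp add: mcst_algorithm_def bind_tm_def RV)
qed

section \<open>Running time\<close>

lemma steps_fill_sums: "steps (fill_sums n r v i RV V) = 12 * (n - i) + 1"
proof (induction n r v i RV V rule: fill_sums.induct)
  case (1 n r v i RV V)
  show ?case
  proof (cases "i < n")
    case True
    then have "steps (fill_sums n r v i RV V) = 12 + (12 * (n - (i + 1)) + 1)"
      using "1.IH" by (subst fill_sums.simps) (simp add: tm_defs)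
    then show ?thesis
      using True by simp
  next
    case False
    then show ?thesis
      by (subst fill_sums.simps) (simp add: tm_defs)
  qed
qed

lemma steps_output_upto: "steps (output_upto k) = 2 * k + 1"
  by (induction k) (auto simp: tm_defs)

text \<open>
  Writing out \<open>{1..n}\<close> is charged in full wherever the loop stops, which makes the bound
  uniform in the array contents.
\<close>

lemma steps_scan_le: "steps (scan n r RV V i) \<le> 9 * (Suc n - i) + 2 * n + 2"
proof (induction n r RV V i rule: scan.induct)
  case (1 n r RV V i)
  show ?case
  proof (cases "i \<le> n")
    case True
    show ?thesis
    proof (cases "r i - RV (i - 1) / V (i - 1) < 0")
      case neg: True
      then have "steps (scan n r RV V i) = 8 + (2 * (i - 1) + 1)"
        using True by (subst scan.simps) (simp add: tm_defs steps_output_upto)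
      then show ?thesis
        using True by simp
    next
      case pos: False
      then have "steps (scan n r RV V i) = 9 + steps (scan n r RV V (i + 1))"
        using True by (subst scan.simps) (simp add: tm_defs)
      moreover have "steps (scan n r RV V (i + 1)) \<le> 9 * (Suc n - (i + 1)) + 2 * n + 2"
        using True pos by (intro "1.IH") auto
      ultimately show ?thesis
        using True by linarith
    qed
  next
    case False
    then show ?thesis
      by (subst scan.simps) (simp add: tm_defs steps_output_upto)
  qed
qed

lemma steps_mcst_algorithm_le: "steps (mcst_algorithm n v r) \<le> 25 * n + 10"
proof -
  have prefix: "steps (prefix_sums n r v) \<le> 14 * n + 8"
    by (simp add: prefix_sums_def tm_defs steps_fill_sums)
  obtain RV V where "result (prefix_sums n r v) = (RV, V)"
    by (cases "result (prefix_sums n r v)")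
  then have "steps (mcst_algorithm n v r) = steps (prefix_sums n r v) + steps (scan n r RV V 2)"
    by (simp add: mcst_algorithm_def bind_tm_def)
  then show ?thesis
    using prefix steps_scan_le[of n r RV V 2] by linarith
qed

section \<open>Optimality in linear time\<close>

theorem theorem2:
  "\<exists>T :: nat \<Rightarrow> nat.
     (\<lambda>n. real (T n)) \<in> O(\<lambda>n. real n) \<and>
     (\<forall>(n::nat) (lam :: nat \<Rightarrow> real) (v :: nat \<Rightarrow> real) (r :: nat \<Rightarrow> real).
        homogeneous_mcst n lam v \<and>
        (\<forall>i j. 1 \<le> i \<and> i \<le> j \<and> j \<le> n \<longrightarrow> r j \<le> r i) \<and>
        0 \<le> r 1 \<longrightarrow>
          steps (mcst_algorithm n v r) \<le> T n \<and>
          mcst_optimal n lam v r (result (mcst_algorithm n v r)))"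
proof (intro exI[of _ "\<lambda>n. 25 * n + 10"] conjI allI impI; (elim conjE)?)
  show "(\<lambda>n. real (25 * n + 10)) \<in> O(\<lambda>n. real n)"
    by (rule bigoI[of _ 35]) (auto simp: eventually_at_top_linorder intro!: exI[of _ 1])
next
  fix n and lam v r :: "nat \<Rightarrow> real"
  show "steps (mcst_algorithm n v r) \<le> 25 * n + 10"
    by (rule steps_mcst_algorithm_le)
next
  fix n and lam v r :: "nat \<Rightarrow> real"
  assume mcst: "homogeneous_mcst n lam v"
    and sorted: "\<forall>i j. 1 \<le> i \<and> i \<le> j \<and> j \<le> n \<longrightarrow> r j \<le> r i" and r1: "0 \<le> r 1"
  (* The arrival probabilities sum to 1, so there is a product. *)
  have "1 \<le> n"
    using mcst by (cases n) (auto simp: homogeneous_mcst_def)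
  then obtain k where "result (mcst_algorithm n v r) = {1..k}" "stopping_index n v r k"
    using mcst_algorithm_returns_stopping_index by blast
  then show "mcst_optimal n lam v r (result (mcst_algorithm n v r))"
    using mcst_optimal_if_stopping_index[of n lam v r k] mcst sorted r1 by simp
qed

end
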